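(* Let $k\ge 1$ and $n_1,\ldots,n_k\ge 1$ be integers, and let $G=P_{n_1}\Box P_{n_2}\Box\cdots\Box P_{n_k}$ be the $k$-dimensional grid with dimensions $n_1,\ldots,n_k$ (where $P_m$ is the path on $m$ vertices). Then $G$ has outcome $\mathcal{N}$ for \textsc{Closed Geodetic Game} if and only if all of $n_1,\ldots,n_k$ are odd.
   Context: The Cartesian product $G\,\Box\, H$ has vertex set $V(G)\times V(H)$, with $(u_1,v_1)$ adjacent to $(u_2,v_2)$ iff either $u_1=u_2$ and $v_1v_2\in E(H)$, or $v_1=v_2$ and $u_1u_2\in E(G)$. For vertices $x,y$, $\mathcal{I}(x,y)$ is the set of vertices on some shortest $x$–$y$ path ($\mathcal{I}(x,x)=\{x\}$); for a vertex set $S$, the geodetic closure is $(S)=\bigcup_{x,y\in S}\mathcal{I}(x,y)$. \textsc{Closed Geodetic Game}: starting from $S=\emptyset$, two players alternately add to $S$ a vertex not in the current closure $(S)$; the game ends when $(S)$ is the whole vertex set, and the player who made the last move wins. Outcome $\mathcal{N}$ means the first player has a winning strategy. *)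

theory Defs
  imports "Graph_Theory.Graph_Theory"
begin

text \<open>
  A simple graph is represented, following Graph_Theory, by a pair digraph without loops whose
  arc set is symmetric (locale \<^locale>\<open>pair_graph\<close>): the edge \<open>uv\<close> is the pair of arcs
  \<open>(u,v)\<close>, \<open>(v,u)\<close>.
\<close>

definition path_graph :: "nat \<Rightarrow> nat pair_pre_digraph" where
  "path_graph m = \<lparr> pverts = {..<m},
     parcs = {(i, j). i < m \<and> j < m \<and> (j = Suc i \<or> i = Suc j)} \<rparr>"

definition cart_prod :: "'a pair_pre_digraph \<Rightarrow> 'b pair_pre_digraph \<Rightarrow> ('a \<times> 'b) pair_pre_digraph"
    (infixr "\<box>" 70) where
  "G \<box> H = \<lparr> pverts = pverts G \<times> pverts H,
     parcs = {((u1, v1), (u2, v2)).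
       (u1 = u2 \<and> u1 \<in> pverts G \<and> (v1, v2) \<in> parcs H) \<or>
       (v1 = v2 \<and> v1 \<in> pverts H \<and> (u1, u2) \<in> parcs G)} \<rparr>"

definition relabel :: "('a \<Rightarrow> 'b) \<Rightarrow> 'a pair_pre_digraph \<Rightarrow> 'b pair_pre_digraph" where
  "relabel f G = \<lparr> pverts = f ` pverts G, parcs = map_prod f f ` parcs G \<rparr>"

text \<open>
  The iterated product of paths. Tuples are encoded as lists, so that the number of factors can
  vary; the (injective) relabelling turns a pair \<open>(x, xs)\<close> into the list \<open>x # xs\<close>.
  The empty product is the one-vertex graph.
\<close>

fun grid :: "nat list \<Rightarrow> nat list pair_pre_digraph" where
  "grid [] = \<lparr> pverts = {[]}, parcs = {} \<rparr>"
| "grid (n # ns) = relabel (\<lambda>(x, xs). x # xs) (path_graph n \<box> grid ns)"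

definition shortest_path :: "'a pair_pre_digraph \<Rightarrow> 'a \<Rightarrow> ('a \<times> 'a) awalk \<Rightarrow> 'a \<Rightarrow> bool" where
  "shortest_path G x p y \<longleftrightarrow> pre_digraph.apath G x p y \<and>
     (\<forall>q. pre_digraph.apath G x q y \<longrightarrow> length p \<le> length q)"

definition geod_interval :: "'a pair_pre_digraph \<Rightarrow> 'a \<Rightarrow> 'a \<Rightarrow> 'a set" where
  "geod_interval G x y =
     {z. \<exists>p. shortest_path G x p y \<and> z \<in> set (pre_digraph.awalk_verts G x p)}"

definition geod_closure :: "'a pair_pre_digraph \<Rightarrow> 'a set \<Rightarrow> 'a set" where
  "geod_closure G S = (\<Union>x\<in>S. \<Union>y\<in>S. geod_interval G x y)"

text \<open>
  A position of the closed geodetic game is recorded by the list \<open>p\<close> of the moves made so far,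
  oldest first; the set \<open>S\<close> of the game is \<^term>\<open>set p\<close>. The first player makes the moves with
  even index.
\<close>

definition legal_move :: "'a pair_pre_digraph \<Rightarrow> 'a list \<Rightarrow> 'a \<Rightarrow> bool" where
  "legal_move G p v \<longleftrightarrow> v \<in> pverts G \<and> v \<notin> geod_closure G (set p)"

definition legal_play :: "'a pair_pre_digraph \<Rightarrow> 'a list \<Rightarrow> bool" where
  "legal_play G p \<longleftrightarrow> (\<forall>i < length p. legal_move G (take i p) (p ! i))"

definition game_over :: "'a pair_pre_digraph \<Rightarrow> 'a list \<Rightarrow> bool" where
  "game_over G p \<longleftrightarrow> geod_closure G (set p) = pverts G"

definition first_follows :: "('a list \<Rightarrow> 'a) \<Rightarrow> 'a list \<Rightarrow> bool" where
  "first_follows \<sigma> p \<longleftrightarrow> (\<forall>i < length p. even i \<longrightarrow> p ! i = \<sigma> (take i p))"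

text \<open>
  A winning strategy of the first player always provides a legal move when it is the first
  player's turn, and every finished play following it has its last move made by the first player,
  that is, has odd length. On a finite graph, every play does finish, since no vertex is chosen twice.
\<close>

definition first_wins_with :: "'a pair_pre_digraph \<Rightarrow> ('a list \<Rightarrow> 'a) \<Rightarrow> bool" where
  "first_wins_with G \<sigma> \<longleftrightarrow> (\<forall>p. legal_play G p \<and> first_follows \<sigma> p \<longrightarrow>
     (\<not> game_over G p \<and> even (length p) \<longrightarrow> legal_move G p (\<sigma> p)) \<and>
     (game_over G p \<longrightarrow> odd (length p)))"

definition outcome_N :: "'a pair_pre_digraph \<Rightarrow> bool" where
  "outcome_N G \<longleftrightarrow> (\<exists>\<sigma>. first_wins_with G \<sigma>)"

lemma pverts_grid: "pverts (grid ns) = {xs. length xs = length ns \<and> (\<forall>i < length ns. xs ! i < ns ! i)}"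
proof (induction ns)
  case Nil
  then show ?case by auto
next
  case (Cons n ns)
  have "xs \<in> pverts (grid (n # ns)) \<longleftrightarrow> (\<exists>y ys. xs = y # ys \<and> y < n \<and> ys \<in> pverts (grid ns))" for xs
    by (auto simp: relabel_def cart_prod_def path_graph_def image_iff)
  also have "\<dots> xs \<longleftrightarrow> length xs = length (n # ns) \<and> (\<forall>i < length (n # ns). xs ! i < (n # ns) ! i)" for xs
    by (cases xs) (auto simp: Cons.IH All_less_Suc2)
  finally show ?case by blast
qed

lemma pair_graph_grid: "pair_graph (grid ns)"
proof (induction ns)
  case Nil
  then show ?case
    by unfold_locales (auto simp: symmetric_def sym_def)
next
  case (Cons n ns)
  interpret H: pair_graph "grid ns" by fact
  have wf: "parcs (grid (n # ns)) \<subseteq> pverts (grid (n # ns)) \<times> pverts (grid (n # ns))"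
    by (auto simp: relabel_def cart_prod_def path_graph_def image_iff dest: H.wellformed')
  have fin: "finite (pverts (grid (n # ns)))"
    using H.pair_finite_verts by (auto simp: relabel_def cart_prod_def path_graph_def)
  have arcs: "(xs, zs) \<in> parcs (grid (n # ns)) \<longleftrightarrow>
      (\<exists>x xs' z zs'. xs = x # xs' \<and> zs = z # zs' \<and>
        ((x = z \<and> x < n \<and> (xs', zs') \<in> parcs (grid ns)) \<or>
         (xs' = zs' \<and> xs' \<in> pverts (grid ns) \<and> (x, z) \<in> parcs (path_graph n))))" for xs zs
    by (force simp: relabel_def cart_prod_def path_graph_def image_iff)
  have symH: "(b, a) \<in> parcs (grid ns)" if "(a, b) \<in> parcs (grid ns)" for a b
    using H.pair_sym_arcs that by (auto simp: symmetric_def dest: symD)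
  show ?case
  proof unfold_locales
    show "finite (parcs (grid (n # ns)))"
      using wf fin by (meson finite_SigmaI finite_subset)
    show "symmetric (with_proj (grid (n # ns)))"
      unfolding symmetric_def with_proj_simps
      by (rule symI, unfold arcs) (auto simp: path_graph_def dest: symH)
    show "fst e \<noteq> snd e" if "e \<in> parcs (grid (n # ns))" for e
      using that by (cases e) (auto simp del: grid.simps simp: arcs path_graph_def dest: H.pair_no_loops)
  qed (use wf fin in auto)
qed

lemma geod_interval_refl:
  assumes "x \<in> pverts G"
  shows "geod_interval G x x = {x}"
proof -
  have "pre_digraph.apath G x [] x"
    using assms
    by (simp add: pre_digraph.apath_def pre_digraph.awalk_def pre_digraph.cas.simps
        pre_digraph.awalk_verts.simps)
  then have "shortest_path G x p x \<longleftrightarrow> p = []" for p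
    by (auto simp: shortest_path_def)
  then show ?thesis
    by (auto simp: geod_interval_def pre_digraph.awalk_verts.simps)
qed

end

theory Submission
  imports Defs
begin

text \<open>
  Geodesic intervals of a grid are coordinatewise boxes. Let \<open>c\<close> be the reflection of the grid in
  its centre. If \<open>S\<close> is invariant under \<open>c\<close> and \<open>v\<close> is a legal move, then the reply \<open>c v\<close> is legal
  unless \<open>c v = v\<close>: in each coordinate, if \<open>c v\<close> lies between \<open>x\<close> and \<open>v\<close>, then \<open>v\<close> lies between
  \<open>x\<close> and \<open>c x\<close>, so \<open>c v\<close> could only be covered if \<open>v\<close> had been covered before. The reflection has a
  fixed point, namely the centre, exactly if all dimensions are odd. Hence in this case the first
  player wins by opening with the centre and mirroring from then on, and otherwise the second
  player wins by mirroring.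
\<close>

section \<open>Geodesic intervals from a distance function\<close>

text \<open>These axioms force \<open>d\<close> to be the graph distance: \<open>dist_arc\<close>
  makes it a lower bound on walk lengths, and following \<open>dist_descent\<close> down to 0 yields
  a walk attaining the bound.\<close>

locale graph_distance = pair_wf_digraph G for G :: "'a pair_pre_digraph" +
  fixes d :: "'a \<Rightarrow> 'a \<Rightarrow> nat"
  assumes dist_refl: "x \<in> pverts G \<Longrightarrow> d x x = 0"
    and dist_arc: "(x, x') \<in> parcs G \<Longrightarrow> y \<in> pverts G \<Longrightarrow> d x y \<le> Suc (d x' y)"
    and dist_descent: "x \<in> pverts G \<Longrightarrow> y \<in> pverts G \<Longrightarrow> x \<noteq> y \<Longrightarrow>
      \<exists>x'. (x, x') \<in> parcs G \<and> d x y = Suc (d x' y)"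
begin

lemma dist_le_length: "awalk x p y \<Longrightarrow> d x y \<le> length p"
proof (induction p arbitrary: x)
  case Nil
  then have "x = y" "x \<in> pverts G" by (auto simp: awalk_Nil_iff)
  then show ?case using dist_refl by simp
next
  case (Cons e p)
  then have "e \<in> parcs G" "fst e = x" "awalk (snd e) p y"
    by (auto simp: awalk_Cons_iff)
  moreover from this have "d x y \<le> Suc (d (snd e) y)"
    by (intro dist_arc) (auto simp: awalk_last_in_verts)
  ultimately show ?case using Cons.IH by fastforce
qed

lemma ex_awalk_dist:
  assumes "x \<in> pverts G" "y \<in> pverts G"
  shows "\<exists>p. awalk x p y \<and> length p = d x y"
  using assms
proof (induction "d x y" arbitrary: x)
  case 0
  then show ?case using dist_descent by (metis awalk_Nil_iff list.size(3) nat.distinct(1))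
next
  case (Suc n)
  then have "x \<noteq> y" using dist_refl by auto
  then obtain x' where x': "(x, x') \<in> parcs G" "d x y = Suc (d x' y)"
    using dist_descent Suc.prems by blast
  then obtain p where "awalk x' p y" "length p = d x' y"
    using Suc by (metis in_arcsD2 nat.inject)
  then have "awalk x ((x, x') # p) y \<and> length ((x, x') # p) = d x y"
    using x' by (simp add: awalk_Cons_iff)
  then show ?case by blast
qed

text \<open>Bridges walks and the paths in \<open>shortest_path\<close>: a return to
  \<open>x\<close> would leave a tail from \<open>x\<close> to \<open>y\<close> that is shorter than
  \<open>d x y\<close>.\<close>

lemma apath_if_length_eq_dist:
  assumes "awalk x p y" "length p = d x y"
  shows "apath x p y"
  using assms
proof (induction p arbitrary: x)
  case Nil
  then show ?case by (auto simp: apath_Nil_iff awalk_Nil_iff)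
next
  case (Cons e p)
  then have e: "e \<in> parcs G" "fst e = x" and walk: "awalk (snd e) p y"
    by (auto simp: awalk_Cons_iff)
  have "d x y \<le> Suc (d (snd e) y)"
    using e walk by (intro dist_arc) (auto simp: awalk_last_in_verts)
  then have "length p = d (snd e) y"
    using dist_le_length[OF walk] Cons.prems by simp
  then have "apath (snd e) p y" using walk Cons.IH by blast
  moreover have "x \<notin> set (pawalk_verts (snd e) p)"
  proof
    assume "x \<in> set (pawalk_verts (snd e) p)"
    then obtain q r where "p = q @ r" "awalk x r y"
      using awalk_decomp[OF walk] by blast
    then show False using dist_le_length[of x r y] Cons.prems by simp
  qed
  ultimately show ?case using e by (simp add: apath_Cons_iff)
qed

lemma shortest_path_iff:
  assumes "x \<in> pverts G" "y \<in> pverts G"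
  shows "shortest_path G x p y \<longleftrightarrow> awalk x p y \<and> length p = d x y"
proof
  assume sp: "shortest_path G x p y"
  then have "awalk x p y" by (simp add: shortest_path_def apath_def)
  moreover obtain q where "awalk x q y" "length q = d x y"
    using ex_awalk_dist assms by blast
  then have "length p \<le> d x y"
    using sp apath_if_length_eq_dist unfolding shortest_path_def by metis
  ultimately show "awalk x p y \<and> length p = d x y" using dist_le_length by fastforce
next
  assume "awalk x p y \<and> length p = d x y"
  then show "shortest_path G x p y"
    unfolding shortest_path_def
    by (metis apath_if_length_eq_dist awalkI_apath dist_le_length)
qed

text \<open>Cut a shortest walk at \<open>z\<close>, or conversely concatenate shortest walks to and
  from \<open>z\<close>.\<close>

lemma geod_interval_iff:
  assumes "x \<in> pverts G" "y \<in> pverts G"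
  shows "z \<in> geod_interval G x y \<longleftrightarrow> z \<in> pverts G \<and> d x z + d z y \<le> d x y"
proof
  assume "z \<in> geod_interval G x y"
  then obtain p where p: "awalk x p y" "length p = d x y" "z \<in> set (pawalk_verts x p)"
    using assms by (auto simp: geod_interval_def shortest_path_iff awalk_verts_with_proj_eq)
  then obtain q r where qr: "p = q @ r" "awalk x q z" "awalk z r y"
    using awalk_decomp by blast
  then have "d x z \<le> length q" "d z y \<le> length r" using dist_le_length by auto
  then show "z \<in> pverts G \<and> d x z + d z y \<le> d x y"
    using p qr by (auto simp: awalk_hd_in_verts)
next
  assume z: "z \<in> pverts G \<and> d x z + d z y \<le> d x y"
  obtain q r where q: "awalk x q z" "length q = d x z" and r: "awalk z r y" "length r = d z y"
    using ex_awalk_dist assms z by metis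
  have walk: "awalk x (q @ r) y" using q r by (blast intro: awalk_appendI)
  \<comment> \<open>No walk is shorter than \<open>d x y\<close>, so the assumed
    \<open>\<le>\<close> becomes an equality.\<close>
  then have "shortest_path G x (q @ r) y"
    using dist_le_length[OF walk] z q r assms by (simp add: shortest_path_iff)
  moreover have "z \<in> set (pawalk_verts x (q @ r))"
    using walk r(1) q(1) by (auto simp: awalk_verts_append hd_in_awalk_verts)
  ultimately show "z \<in> geod_interval G x y"
    by (auto simp: geod_interval_def awalk_verts_with_proj_eq)
qed

end

section \<open>The grid\<close>

text \<open>The Manhattan distance: with truncated subtraction, \<open>(x - y) + (y - x)\<close> is
  the absolute difference.\<close>

fun grid_dist :: "nat list \<Rightarrow> nat list \<Rightarrow> nat" where
  "grid_dist (x # xs) (y # ys) = (x - y) + (y - x) + grid_dist xs ys"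
| "grid_dist _ _ = 0"

lemma parcs_grid_Cons_iff:
  "(x # xs, y # ys) \<in> parcs (grid (n # ns)) \<longleftrightarrow>
    (x = y \<and> x < n \<and> (xs, ys) \<in> parcs (grid ns)) \<or>
    (xs = ys \<and> xs \<in> pverts (grid ns) \<and> x < n \<and> y < n \<and> (y = Suc x \<or> x = Suc y))"
  by (force simp: relabel_def cart_prod_def path_graph_def image_iff)

lemma pverts_grid_Cons_iff:
  "xs \<in> pverts (grid (n # ns)) \<longleftrightarrow> (\<exists>y ys. xs = y # ys \<and> y < n \<and> ys \<in> pverts (grid ns))"
  by (auto simp: relabel_def cart_prod_def path_graph_def image_iff)

lemma grid_dist_refl: "grid_dist x x = 0"
  by (induction x) auto

text \<open>An arc changes a single coordinate, and that by one.\<close>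

lemma grid_arc_dist:
  "(x, x') \<in> parcs (grid ns) \<Longrightarrow> y \<in> pverts (grid ns) \<Longrightarrow>
    grid_dist x y \<le> Suc (grid_dist x' y)"
proof (induction ns arbitrary: x x' y)
  case Nil
  then show ?case by simp
next
  case (Cons n ns)
  interpret pair_graph "grid (n # ns)" by (rule pair_graph_grid)
  have "x \<in> pverts (grid (n # ns))" "x' \<in> pverts (grid (n # ns))"
    using Cons.prems(1) by (blast dest: wellformed')+
  then obtain a as b bs c cs where
    eqs: "x = a # as" "x' = b # bs" "y = c # cs" and cs: "cs \<in> pverts (grid ns)"
    using Cons.prems(2) unfolding pverts_grid_Cons_iff by blast
  consider "a = b" "(as, bs) \<in> parcs (grid ns)" | "as = bs" "b = Suc a \<or> a = Suc b"
    using Cons.prems(1) unfolding eqs parcs_grid_Cons_iff by blast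
  then show ?case
  proof cases
    case 1
    then show ?thesis using Cons.IH cs eqs by fastforce
  next
    case 2
    then show ?thesis using eqs by auto
  qed
qed

text \<open>Step towards \<open>y\<close> in the first coordinate where the two vertices
  differ.\<close>

lemma grid_dist_descent:
  "x \<in> pverts (grid ns) \<Longrightarrow> y \<in> pverts (grid ns) \<Longrightarrow> x \<noteq> y \<Longrightarrow>
    \<exists>x'. (x, x') \<in> parcs (grid ns) \<and> grid_dist x y = Suc (grid_dist x' y)"
proof (induction ns arbitrary: x y)
  case Nil
  then show ?case by simp
next
  case (Cons n ns)
  then obtain a as b bs where
    x: "x = a # as" "a < n" "as \<in> pverts (grid ns)" and
    y: "y = b # bs" "b < n" "bs \<in> pverts (grid ns)"
    unfolding pverts_grid_Cons_iff by blast
  consider "a < b" | "b < a" | "a = b" "as \<noteq> bs" using Cons.prems(3) x y by fastforce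
  then show ?case
  proof cases
    case 1
    then have "(x, Suc a # as) \<in> parcs (grid (n # ns))"
      using x y unfolding x(1) parcs_grid_Cons_iff by simp
    moreover have "grid_dist x y = Suc (grid_dist (Suc a # as) y)" using 1 x y by simp
    ultimately show ?thesis by blast
  next
    case 2
    then have "(x, (a - 1) # as) \<in> parcs (grid (n # ns))"
      using x y unfolding x(1) parcs_grid_Cons_iff by auto
    moreover have "grid_dist x y = Suc (grid_dist ((a - 1) # as) y)" using 2 x y by simp
    ultimately show ?thesis by blast
  next
    case 3
    then obtain as' where "(as, as') \<in> parcs (grid ns)" "grid_dist as bs = Suc (grid_dist as' bs)"
      using Cons.IH x y by blast
    then have "(x, a # as') \<in> parcs (grid (n # ns))" "grid_dist x y = Suc (grid_dist (a # as') y)"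
      using x y 3 unfolding x(1) parcs_grid_Cons_iff by auto
    then show ?thesis by blast
  qed
qed

lemma grid_dist_triangle:
  "length x = length y \<Longrightarrow> length y = length z \<Longrightarrow> grid_dist x z \<le> grid_dist x y + grid_dist y z"
  by (induction x y z rule: list_induct3) auto

lemma grid_dist_add_le_iff:
  "length x = length z \<Longrightarrow> length z = length y \<Longrightarrow>
    grid_dist x z + grid_dist z y \<le> grid_dist x y \<longleftrightarrow>
    (\<forall>i < length z. min (x ! i) (y ! i) \<le> z ! i \<and> z ! i \<le> max (x ! i) (y ! i))"
proof (induction x z y rule: list_induct3)
  case Nil
  then show ?case by simp
next
  case (Cons a x b z c y)
  \<comment> \<open>With the triangle inequality for the tails, no slack there can offset an excess
    in the head, so the inequality splits coordinatewise.\<close>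
  have "grid_dist x y \<le> grid_dist x z + grid_dist z y"
    using Cons.hyps by (intro grid_dist_triangle)
  then have "grid_dist (a # x) (b # z) + grid_dist (b # z) (c # y) \<le> grid_dist (a # x) (c # y) \<longleftrightarrow>
      grid_dist x z + grid_dist z y \<le> grid_dist x y \<and> min a c \<le> b \<and> b \<le> max a c"
    by (auto simp: min_def max_def)
  also have "\<dots> \<longleftrightarrow> (\<forall>i < length (b # z). min ((a # x) ! i) ((c # y) ! i) \<le> (b # z) ! i \<and>
      (b # z) ! i \<le> max ((a # x) ! i) ((c # y) ! i))"
    unfolding Cons.IH by (auto simp: All_less_Suc2)
  finally show ?case .
qed

lemma geod_interval_grid:
  assumes "x \<in> pverts (grid ns)" "y \<in> pverts (grid ns)"
  shows "z \<in> geod_interval (grid ns) x y \<longleftrightarrow> z \<in> pverts (grid ns) \<and>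
    (\<forall>i < length ns. min (x ! i) (y ! i) \<le> z ! i \<and> z ! i \<le> max (x ! i) (y ! i))"
proof -
  interpret pair_graph "grid ns" by (rule pair_graph_grid)
  interpret graph_distance "grid ns" grid_dist
    by unfold_locales (auto intro: grid_dist_refl grid_arc_dist grid_dist_descent)
  show ?thesis
    unfolding geod_interval_iff[OF assms]
    using assms by (auto simp: pverts_grid grid_dist_add_le_iff)
qed

text \<open>The reflection in the centre: coordinates run from 0 to \<open>n - 1\<close>, so on grid
  vertices no subtraction is truncated.\<close>

definition reflect :: "nat list \<Rightarrow> nat list \<Rightarrow> nat list" where
  "reflect ns x = map2 (\<lambda>n a. n - 1 - a) ns x"

lemma length_reflect [simp]: "length (reflect ns x) = min (length ns) (length x)"
  by (simp add: reflect_def)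

lemma nth_reflect [simp]:
  "i < length ns \<Longrightarrow> i < length x \<Longrightarrow> reflect ns x ! i = ns ! i - 1 - x ! i"
  by (simp add: reflect_def)

lemma reflect_in_grid: "x \<in> pverts (grid ns) \<Longrightarrow> reflect ns x \<in> pverts (grid ns)"
  by (fastforce simp: pverts_grid)

section \<open>The mirror strategy\<close>

text \<open>Beyond an involution respecting intervals, the decisive axiom is
  \<open>mirror_between\<close>: a reply \<open>c v\<close> covered by \<open>v\<close> and an old
  \<open>x\<close> would mean that \<open>x\<close> and \<open>c x\<close> already covered
  \<open>v\<close>.\<close>

locale mirror = pair_fin_digraph G for G :: "'a pair_pre_digraph" +
  fixes c :: "'a \<Rightarrow> 'a"
  assumes mirror_closed: "v \<in> pverts G \<Longrightarrow> c v \<in> pverts G"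
    and mirror_mirror: "v \<in> pverts G \<Longrightarrow> c (c v) = v"
    and mirror_interval: "x \<in> pverts G \<Longrightarrow> y \<in> pverts G \<Longrightarrow> z \<in> geod_interval G x y \<Longrightarrow>
      c z \<in> geod_interval G (c x) (c y)"
    and interval_commute: "x \<in> pverts G \<Longrightarrow> y \<in> pverts G \<Longrightarrow>
      geod_interval G x y = geod_interval G y x"
    and mirror_between: "x \<in> pverts G \<Longrightarrow> v \<in> pverts G \<Longrightarrow> c v \<in> geod_interval G x v \<Longrightarrow>
      v \<in> geod_interval G x (c x)"
begin

lemma legal_mirror_move:
  assumes "set p \<subseteq> pverts G" "c ` set p \<subseteq> set p" "legal_move G p v" "c v \<noteq> v"
  shows "legal_move G (p @ [v]) (c v)"
proof -
  have v: "v \<in> pverts G" "\<And>x y. x \<in> set p \<Longrightarrow> y \<in> set p \<Longrightarrow> v \<notin> geod_interval G x y"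
    using assms(3) by (auto simp: legal_move_def geod_closure_def)
  \<comment> \<open>Otherwise \<open>c (c v) = v\<close> would lie between the old vertices
    \<open>c x\<close> and \<open>c y\<close>.\<close>
  have old: "c v \<notin> geod_interval G x y" if "x \<in> set p" "y \<in> set p" for x y
    using mirror_interval[of x y "c v"] v assms(1,2) that
    by (metis image_subset_iff mirror_mirror subsetD)
  \<comment> \<open>Since \<open>c x\<close> is old as well, \<open>mirror_between\<close> would put
    \<open>v\<close> into the old closure.\<close>
  have mixed: "c v \<notin> geod_interval G x v" if "x \<in> set p" for x
    using mirror_between[of x v] v assms(1,2) that by blast
  have "c v \<notin> geod_interval G v x" if "x \<in> set p" for x
    using mixed that interval_commute v assms(1) by (metis subsetD)
  moreover have "c v \<notin> geod_interval G v v"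
    using assms(4) geod_interval_refl[OF v(1)] by simp
  ultimately show ?thesis
    using old mixed mirror_closed[OF v(1)] by (auto simp: legal_move_def geod_closure_def)
qed

end

section \<open>Plays and their finiteness\<close>

lemma legal_play_snoc:
  "legal_play G (p @ [v]) \<longleftrightarrow> legal_play G p \<and> legal_move G p v"
  by (auto simp: legal_play_def nth_append less_Suc_eq)

lemma first_follows_snoc:
  "first_follows \<sigma> (p @ [v]) \<longleftrightarrow> first_follows \<sigma> p \<and> (even (length p) \<longrightarrow> v = \<sigma> p)"
  by (auto simp: first_follows_def nth_append less_Suc_eq)

lemma legal_play_subset: "legal_play G p \<Longrightarrow> set p \<subseteq> pverts G"
  by (induction p rule: rev_induct) (auto simp: legal_play_snoc legal_move_def)

text \<open>A chosen vertex lies in its own interval, hence in the closure. This bounds the length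
  of plays by the number of vertices.\<close>

lemma legal_play_distinct: "legal_play G p \<Longrightarrow> distinct p"
proof (induction p rule: rev_induct)
  case Nil
  then show ?case by simp
next
  case (snoc v p)
  then have "v \<notin> geod_closure G (set p)" "v \<in> pverts G"
    by (auto simp: legal_play_snoc legal_move_def)
  then have "v \<notin> set p"
    using geod_interval_refl by (fastforce simp: geod_closure_def)
  then show ?case using snoc by (simp add: legal_play_snoc)
qed

lemma not_game_over_if_legal_move: "legal_move G p v \<Longrightarrow> \<not> game_over G p"
  by (auto simp: legal_move_def game_over_def)

section \<open>The outcome decided by mirroring\<close>

context mirror
begin

text \<open>Mirroring against a supposed winning strategy can be continued forever, which
  contradicts finiteness.\<close>

lemma not_outcome_N_if_no_fixed_point:
  assumes "\<And>v. v \<in> pverts G \<Longrightarrow> c v \<noteq> v"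
  shows "\<not> outcome_N G"
proof
  assume "outcome_N G"
  then obtain \<sigma> where win: "first_wins_with G \<sigma>" by (auto simp: outcome_N_def)
  have "\<exists>p. legal_play G p \<and> first_follows \<sigma> p \<and> length p = 2 * m \<and> c ` set p \<subseteq> set p" for m
  proof (induction m)
    case 0
    show ?case by (rule exI[of _ "[]"]) (simp add: legal_play_def first_follows_def)
  next
    case (Suc m)
    then obtain p where p: "legal_play G p" "first_follows \<sigma> p" "length p = 2 * m"
      "c ` set p \<subseteq> set p" by blast
    define v where "v = \<sigma> p"
    \<comment> \<open>As \<open>p\<close> has even length and \<open>\<sigma>\<close> wins, the game
      is not over at \<open>p\<close>, so \<open>\<sigma>\<close> must supply a legal move.\<close>
    have v: "legal_move G p v"
      using win p unfolding first_wins_with_def v_def by fastforce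
    then have "v \<in> pverts G" by (simp add: legal_move_def)
    moreover have "legal_move G (p @ [v]) (c v)"
      using legal_mirror_move[OF legal_play_subset] p v assms(1) \<open>v \<in> pverts G\<close> by blast
    ultimately show ?case
      using p v
      by (intro exI[of _ "(p @ [v]) @ [c v]"])
        (auto simp: legal_play_snoc first_follows_snoc v_def mirror_mirror
          simp del: append_assoc)
  qed
  \<comment> \<open>This many distinct moves exceed the number of vertices.\<close>
  then obtain p where p: "legal_play G p" "length p = 2 * Suc (card (pverts G))" by blast
  then have "length p \<le> card (pverts G)"
    using legal_play_subset legal_play_distinct pair_finite_verts
    by (metis card_mono distinct_card)
  then show False using p by simp
qed

lemma outcome_N_if_unique_fixed_point:
  assumes z: "z \<in> pverts G" "c z = z" and unique: "\<And>v. v \<in> pverts G \<Longrightarrow> c v = v \<Longrightarrow> v = z"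
  shows "outcome_N G"
proof -
  define \<sigma> where "\<sigma> p = (if p = [] then z else c (last p))" for p
  \<comment> \<open>After a move of the first player the position is symmetric; after one of the
    opponent it is so up to the last, still unanswered move. Keeping \<open>z\<close> in
    \<open>q\<close> bars the opponent from the fixed point.\<close>
  have sym: "p \<noteq> [] \<longrightarrow> (let q = if odd (length p) then p else butlast p in z \<in> set q \<and> c ` set q \<subseteq> set q)"
    if "legal_play G p" "first_follows \<sigma> p" for p
    using that
  proof (induction p rule: rev_induct)
    case Nil
    show ?case by simp
  next
    case (snoc v p)
    then have IH: "p \<noteq> [] \<longrightarrow> (let q = if odd (length p) then p else butlast p
        in z \<in> set q \<and> c ` set q \<subseteq> set q)"
      and v_eq: "even (length p) \<longrightarrow> v = \<sigma> p" and sub: "set p \<subseteq> pverts G"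
      using legal_play_subset by (auto simp: legal_play_snoc first_follows_snoc)
    show ?case
    proof (cases p rule: rev_cases)
      case Nil
      then show ?thesis using v_eq z by (simp add: \<sigma>_def)
    next
      case (snoc q w)
      show ?thesis
      proof (cases "even (length p)")
        case True
        then have q: "z \<in> set q" "c ` set q \<subseteq> set q" and v: "v = c w"
          using IH v_eq snoc by (auto simp: \<sigma>_def)
        then have "c v = w" using sub snoc by (simp add: mirror_mirror)
        then show ?thesis using True q v snoc by auto
      next
        case False
        then show ?thesis using IH snoc by (simp add: Let_def butlast_append)
      qed
    qed
  qed
  have legal: "legal_move G p (\<sigma> p)"
    if p: "legal_play G p" "first_follows \<sigma> p" "even (length p)" for p
  proof (cases p rule: rev_cases)
    case Nil
    then show ?thesis using z by (simp add: \<sigma>_def legal_move_def geod_closure_def)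
  next
    case (snoc q v)
    then have q: "z \<in> set q" "c ` set q \<subseteq> set q" "set q \<subseteq> pverts G" and v: "legal_move G q v"
      using sym[OF p(1,2)] p legal_play_subset by (auto simp: legal_play_snoc)
    \<comment> \<open>The centre is already taken, so the opponent's move is not fixed by
      \<open>c\<close> and \<open>legal_mirror_move\<close> applies.\<close>
    have "v \<noteq> z"
      using legal_play_distinct[OF p(1)] q snoc by auto
    then have "c v \<noteq> v" using unique v by (auto simp: legal_move_def)
    then show ?thesis using legal_mirror_move q v snoc by (simp add: \<sigma>_def)
  qed
  \<comment> \<open>At even length a legal move always exists, so the game can only end at odd
    length.\<close>
  then have "first_wins_with G \<sigma>"
    unfolding first_wins_with_def by (metis not_game_over_if_legal_move)
  then show ?thesis by (auto simp: outcome_N_def)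
qed

end

section \<open>The central reflection as a mirror, and its fixed point\<close>

lemma mirror_grid: "mirror (grid ns) (reflect ns)"
proof -
  interpret pair_graph "grid ns" by (rule pair_graph_grid)
  show ?thesis
  proof unfold_locales
    fix x y z v
    show "reflect ns v \<in> pverts (grid ns)" if "v \<in> pverts (grid ns)"
      using that by (rule reflect_in_grid)
    show "reflect ns (reflect ns v) = v" if "v \<in> pverts (grid ns)"
      using that by (fastforce intro: nth_equalityI simp: pverts_grid)
    show "geod_interval (grid ns) x y = geod_interval (grid ns) y x"
      if "x \<in> pverts (grid ns)" "y \<in> pverts (grid ns)"
      using that by (auto simp: geod_interval_grid min.commute max.commute)
    show "reflect ns z \<in> geod_interval (grid ns) (reflect ns x) (reflect ns y)"
      if xy: "x \<in> pverts (grid ns)" "y \<in> pverts (grid ns)"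
        and between: "z \<in> geod_interval (grid ns) x y"
    proof -
      \<comment> \<open>Subtracting from a constant is antitone even when truncated, so the two
        bounds swap.\<close>
      have "min (ns ! i - 1 - x ! i) (ns ! i - 1 - y ! i) \<le> ns ! i - 1 - z ! i \<and>
          ns ! i - 1 - z ! i \<le> max (ns ! i - 1 - x ! i) (ns ! i - 1 - y ! i)"
        if "min (x ! i) (y ! i) \<le> z ! i \<and> z ! i \<le> max (x ! i) (y ! i)" for i
        using that by (auto simp: min_def max_def split: if_splits)
      moreover have "z \<in> pverts (grid ns)" "length x = length ns" "length y = length ns"
        "length z = length ns"
        using xy between by (simp_all add: geod_interval_grid pverts_grid)
      ultimately show ?thesis
        using between
        unfolding geod_interval_grid[OF xy] geod_interval_grid[OF xy[THEN reflect_in_grid]]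
        by (simp add: reflect_in_grid)
    qed
    show "v \<in> geod_interval (grid ns) x (reflect ns x)"
      if x: "x \<in> pverts (grid ns)" and v: "v \<in> pverts (grid ns)"
        and between: "reflect ns v \<in> geod_interval (grid ns) x v"
    proof -
      \<comment> \<open>Put \<open>m = ns ! i - 1\<close>. If \<open>x \<le> m - v \<le> v\<close>
        at \<open>i\<close>, then \<open>x \<le> v \<le> m - x\<close>; the reversed order is
        analogous.\<close>
      have "min (x ! i) (ns ! i - 1 - x ! i) \<le> v ! i \<and> v ! i \<le> max (x ! i) (ns ! i - 1 - x ! i)"
        if "i < length ns" for i
      proof -
        have "x ! i < ns ! i" "v ! i < ns ! i" "length x = length ns" "length v = length ns"
          using x v that by (auto simp: pverts_grid)
        moreover from this have "min (x ! i) (v ! i) \<le> ns ! i - 1 - v ! i"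
          "ns ! i - 1 - v ! i \<le> max (x ! i) (v ! i)"
          using between x v that by (auto simp: geod_interval_grid)
        ultimately show ?thesis by (auto simp: min_def max_def split: if_splits)
      qed
      moreover have "length x = length ns" using x by (simp add: pverts_grid)
      ultimately show ?thesis
        using v unfolding geod_interval_grid[OF x reflect_in_grid[OF x]] by simp
    qed
  qed
qed

lemma reflect_fixed_iff:
  assumes "v \<in> pverts (grid ns)"
  shows "reflect ns v = v \<longleftrightarrow> (\<forall>i < length ns. ns ! i = 2 * v ! i + 1)"
proof -
  have "reflect ns v = v \<longleftrightarrow> (\<forall>i < length ns. ns ! i - 1 - v ! i = v ! i)"
    using assms by (auto simp: list_eq_iff_nth_eq pverts_grid)
  \<comment> \<open>The bound \<open>v ! i < ns ! i\<close> excludes \<open>ns ! i = 0\<close>,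
    where truncation would make 0 a spurious solution.\<close>
  also have "\<dots> \<longleftrightarrow> (\<forall>i < length ns. ns ! i = 2 * v ! i + 1)"
    using assms by (fastforce simp: pverts_grid)
  finally show ?thesis .
qed

theorem theorem3:
  fixes ns :: "nat list"
  assumes "length ns \<ge> 1"
    and "\<forall>n \<in> set ns. n \<ge> 1"
  shows "outcome_N (grid ns) \<longleftrightarrow> (\<forall>n \<in> set ns. odd n)"
proof
  interpret mirror "grid ns" "reflect ns" by (rule mirror_grid)
  show "\<forall>n \<in> set ns. odd n" if "outcome_N (grid ns)"
  proof -
    \<comment> \<open>Without a fixed point the second player could mirror; the coordinates of
      \<open>v\<close> witness that all dimensions are odd.\<close>
    obtain v where "v \<in> pverts (grid ns)" "reflect ns v = v"
      using not_outcome_N_if_no_fixed_point \<open>outcome_N (grid ns)\<close> by blast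
    then show ?thesis by (auto simp: reflect_fixed_iff in_set_conv_nth)
  qed
  show "outcome_N (grid ns)" if "\<forall>n \<in> set ns. odd n"
  proof -
    \<comment> \<open>The centre: for odd \<open>n\<close>, \<open>n div 2\<close> is the only
      solution of \<open>n = 2 * a + 1\<close>, which also gives uniqueness.\<close>
    define z where "z = map (\<lambda>n. n div 2) ns"
    have "ns ! i div 2 < ns ! i" if "i < length ns" for i
      using assms(2) nth_mem[OF that] by fastforce
    then have z: "z \<in> pverts (grid ns)" by (simp add: z_def pverts_grid)
    have "reflect ns z = z"
      unfolding reflect_fixed_iff[OF z] using that by (auto simp: z_def)
    moreover have "v = z" if "v \<in> pverts (grid ns)" "reflect ns v = v" for v
      using that reflect_fixed_iff[of v ns]
      by (auto simp: z_def pverts_grid intro!: nth_equalityI)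
    ultimately show ?thesis using outcome_N_if_unique_fixed_point z by blast
  qed
qed

end
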